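(* Let $\mathcal{M}$ be the graphic matroid induced by the complete graph $K_6$ (ground set: the edges of $K_6$; bases: the spanning trees of $K_6$). The Ollivier--Ricci curvature $\kappa$ of the basis exchange walk on $\mathcal{M}$ satisfies \[\kappa\leq -\frac{2}{25},\] so the basis exchange walk is negatively curved.
   Context: For a matroid $\mathcal{M}=(E,\mathcal{B})$ with set of bases $\mathcal{B}$ all of size $k$, write $B-u$ for $B\setminus\{u\}$. The basis exchange walk (down-up walk) on $\mathcal{M}$ is the Markov chain $P$ on $\mathcal{B}$ that from $S\in\mathcal{B}$ drops an element $u\in S$ chosen uniformly at random, then moves to a uniformly random basis containing $S-u$ (possibly $S$ itself). The metric on $\mathcal{B}$ is $d(S,T)=\inf\{t\ge 0: P^t(S,T)>0\}$. The Wasserstein distance is $\mathcal{W}(\mu,\nu)=\min \mathbb{E}\, d(X,Y)$, the minimum being over all couplings $(X,Y)$ of $X\sim\mu$ and $Y\sim\nu$. The Ollivier--Ricci curvature $\kappa$ of $P$ is the largest $\kappa$ such that $\mathcal{W}(P(S,\cdot),P(T,\cdot))\le(1-\kappa)\,d(S,T)$ for all $S,T\in\mathcal{B}$, i.e. $\kappa=\inf_{S\ne T}\left(1-\mathcal{W}(P(S,\cdot),P(T,\cdot))/d(S,T)\right)$. Negatively curved means $\kappa<0$. *)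

theory Defs
  imports "HOL-Probability.Probability"
begin

section \<open>Matroids and graphic matroids\<close>

locale matroid =
  fixes E :: "'e set" and \<B> :: "'e set set"
  assumes finite_ground: "finite E"
    and bases_subset: "B \<in> \<B> \<Longrightarrow> B \<subseteq> E"
    and bases_nonempty: "\<B> \<noteq> {}"
    and exchange: "\<lbrakk>A \<in> \<B>; B \<in> \<B>; e \<in> A - B\<rbrakk> \<Longrightarrow> \<exists>f \<in> B - A. insert f (A - {e}) \<in> \<B>"

text \<open>Simple graphs are given by a vertex set and a set of two-element sets of vertices.\<close>

definition adj :: "'v set set \<Rightarrow> ('v \<times> 'v) set" where
  "adj E = {(u, v). {u, v} \<in> E}"

definition graph_connected :: "'v set \<Rightarrow> 'v set set \<Rightarrow> bool" where
  "graph_connected V E \<longleftrightarrow> V \<noteq> {} \<and> (\<forall>u \<in> V. \<forall>v \<in> V. (u, v) \<in> (adj E)\<^sup>*)"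

definition graph_cycle :: "'v set set \<Rightarrow> 'v list \<Rightarrow> bool" where
  "graph_cycle E vs \<longleftrightarrow> 3 \<le> length vs \<and> distinct vs \<and>
     successively (\<lambda>u v. {u, v} \<in> E) vs \<and> {last vs, hd vs} \<in> E"

definition graph_acyclic :: "'v set set \<Rightarrow> bool" where
  "graph_acyclic E \<longleftrightarrow> (\<nexists>vs. graph_cycle E vs)"

definition spanning_trees :: "'v set \<Rightarrow> 'v set set \<Rightarrow> 'v set set set" where
  "spanning_trees V E = {T. T \<subseteq> E \<and> graph_connected V T \<and> graph_acyclic T}"

definition complete_edges :: "'v set \<Rightarrow> 'v set set" where
  "complete_edges V = {e. e \<subseteq> V \<and> card e = 2}"

definition K_bases :: "nat \<Rightarrow> nat set set set" where
  "K_bases n = spanning_trees {..<n} (complete_edges {..<n})"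

section \<open>Markov chains and their curvature\<close>

primrec kernel_power :: "('s \<Rightarrow> 's pmf) \<Rightarrow> nat \<Rightarrow> 's \<Rightarrow> 's pmf" where
  "kernel_power P 0 x = return_pmf x"
| "kernel_power P (Suc t) x = bind_pmf (kernel_power P t x) P"

text \<open>The value is \<open>\<infinity>\<close> if \<open>y\<close> cannot be reached from \<open>x\<close>.\<close>

definition chain_dist :: "('s \<Rightarrow> 's pmf) \<Rightarrow> 's \<Rightarrow> 's \<Rightarrow> enat" where
  "chain_dist P x y = (INF t \<in> {t. pmf (kernel_power P t x) y > 0}. enat t)"

definition couplings :: "'s pmf \<Rightarrow> 's pmf \<Rightarrow> ('s \<times> 's) pmf set" where
  "couplings \<mu> \<nu> = {\<xi>. map_pmf fst \<xi> = \<mu> \<and> map_pmf snd \<xi> = \<nu>}"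

text \<open>For finitely supported distributions the infimum is a minimum.\<close>

definition wasserstein :: "('s \<Rightarrow> 's \<Rightarrow> enat) \<Rightarrow> 's pmf \<Rightarrow> 's pmf \<Rightarrow> ennreal" where
  "wasserstein d \<mu> \<nu> =
     (INF \<xi> \<in> couplings \<mu> \<nu>. \<integral>\<^sup>+ z. ennreal_of_enat (d (fst z) (snd z)) \<partial>measure_pmf \<xi>)"

text \<open>
  Distances and costs are extended-valued so that every infimum has its usual meaning.  For an
  irreducible chain on a finite set \<open>\<Omega>\<close>, such as the basis exchange walk, they are all finite.
\<close>

definition ollivier_ricci :: "'s set \<Rightarrow> ('s \<Rightarrow> 's pmf) \<Rightarrow> ereal" where
  "ollivier_ricci \<Omega> P =
     (INF (x, y) \<in> {(x, y). x \<in> \<Omega> \<and> y \<in> \<Omega> \<and> x \<noteq> y}.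
        1 - enn2ereal (wasserstein (chain_dist P) (P x) (P y)) / ereal_of_enat (chain_dist P x y))"

definition negatively_curved :: "'s set \<Rightarrow> ('s \<Rightarrow> 's pmf) \<Rightarrow> bool" where
  "negatively_curved \<Omega> P \<longleftrightarrow> ollivier_ricci \<Omega> P < 0"

definition basis_exchange_walk :: "'e set set \<Rightarrow> 'e set \<Rightarrow> 'e set pmf" where
  "basis_exchange_walk \<B> S =
     bind_pmf (pmf_of_set S) (\<lambda>u. pmf_of_set {T \<in> \<B>. S - {u} \<subseteq> T})"

section \<open>The spanning trees of a connected graph form a matroid\<close>

lemma adj_sym: "(u, v) \<in> (adj E)\<^sup>* \<Longrightarrow> (v, u) \<in> (adj E)\<^sup>*"
proof -
  have "sym (adj E)" by (auto simp: adj_def sym_def insert_commute)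
  then show "(u, v) \<in> (adj E)\<^sup>* \<Longrightarrow> (v, u) \<in> (adj E)\<^sup>*"
    by (meson sym_rtrancl symD)
qed

lemma adj_mono: "E \<subseteq> F \<Longrightarrow> (u, v) \<in> (adj E)\<^sup>* \<Longrightarrow> (u, v) \<in> (adj F)\<^sup>*"
  by (rule subsetD[OF rtrancl_mono]) (auto simp: adj_def)

lemma rtrancl_distinct_path:
  assumes "(u, v) \<in> (adj E)\<^sup>*"
  shows "\<exists>xs. xs \<noteq> [] \<and> hd xs = u \<and> last xs = v \<and> distinct xs \<and>
           successively (\<lambda>x y. {x, y} \<in> E) xs"
  using assms
proof (induction rule: rtrancl_induct)
  case base
  show ?case by (intro exI[of _ "[u]"]) auto
next
  case (step y z)
  then obtain xs where xs: "xs \<noteq> []" "hd xs = u" "last xs = y" "distinct xs"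
    "successively (\<lambda>x y. {x, y} \<in> E) xs" by blast
  show ?case
  proof (cases "z \<in> set xs")
    case True
    then obtain as bs where s: "xs = as @ z # bs" by (meson split_list)
    show ?thesis
    proof (intro exI[of _ "as @ [z]"] conjI)
      show "hd (as @ [z]) = u" using xs s by (cases as) auto
      show "successively (\<lambda>x y. {x, y} \<in> E) (as @ [z])"
        using xs s by (auto simp: successively_append_iff)
    qed (use xs s in auto)
  next
    case False
    show ?thesis
      by (rule exI[of _ "xs @ [z]"])
        (use xs False step in \<open>auto simp: successively_append_iff adj_def\<close>)
  qed
qed

lemma successively_reach:
  assumes "successively (\<lambda>x y. {x, y} \<in> E) xs" "xs \<noteq> []"
  shows "(hd xs, last xs) \<in> (adj E)\<^sup>*"
  using assms
proof (induction xs rule: induct_list012)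
  case (3 x y zs)
  then have "(x, y) \<in> adj E" "(y, last (y # zs)) \<in> (adj E)\<^sup>*"
    by (auto simp: adj_def)
  then show ?case by (auto intro: converse_rtrancl_into_rtrancl)
qed auto

lemma graph_acyclic_iff_bridges:
  "graph_acyclic E \<longleftrightarrow> (\<forall>u v. u \<noteq> v \<longrightarrow> {u, v} \<in> E \<longrightarrow> (u, v) \<notin> (adj (E - {{u, v}}))\<^sup>*)"
proof
  assume ac: "graph_acyclic E"
  show "\<forall>u v. u \<noteq> v \<longrightarrow> {u, v} \<in> E \<longrightarrow> (u, v) \<notin> (adj (E - {{u, v}}))\<^sup>*"
  proof (intro allI impI notI)
    fix u v assume uv: "u \<noteq> v" "{u, v} \<in> E" "(u, v) \<in> (adj (E - {{u, v}}))\<^sup>*"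
    obtain xs where xs: "xs \<noteq> []" "hd xs = u" "last xs = v" "distinct xs"
      "successively (\<lambda>x y. {x, y} \<in> E - {{u, v}}) xs"
      using rtrancl_distinct_path[OF uv(3)] by blast
    have "3 \<le> length xs"
    proof (rule ccontr)
      assume "\<not> 3 \<le> length xs"
      then consider "length xs = 0" | "length xs = 1" | "length xs = 2" by linarith
      then show False
      proof cases
        case 3
        then obtain a b where "xs = [a, b]"
          by (auto simp: numeral_2_eq_2 length_Suc_conv)
        then show False using xs by auto
      qed (use xs uv in \<open>auto simp: length_Suc_conv\<close>)
    qed
    moreover have "successively (\<lambda>x y. {x, y} \<in> E) xs"
      using xs(5) by (rule successively_mono) auto
    ultimately have "graph_cycle E xs"
      using xs uv by (simp add: graph_cycle_def insert_commute)
    then show False using ac by (auto simp: graph_acyclic_def)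
  qed
next
  assume br: "\<forall>u v. u \<noteq> v \<longrightarrow> {u, v} \<in> E \<longrightarrow> (u, v) \<notin> (adj (E - {{u, v}}))\<^sup>*"
  show "graph_acyclic E"
    unfolding graph_acyclic_def
  proof
    assume "\<exists>vs. graph_cycle E vs"
    then obtain vs where vs: "graph_cycle E vs" ..
    then obtain a b c cs where s: "vs = a # b # c # cs"
      by (auto simp: graph_cycle_def numeral_3_eq_3 Suc_le_length_iff)
    define l where "l = last (c # cs)"
    have l: "l \<in> set (c # cs)" unfolding l_def by (rule last_in_set) simp
    have d: "distinct vs" and su: "successively (\<lambda>u v. {u, v} \<in> E) vs" and e: "{l, a} \<in> E"
      using vs s by (auto simp: graph_cycle_def l_def)
    have anin: "a \<notin> set (b # c # cs)" using d s by auto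
    have "successively (\<lambda>u v. {u, v} \<in> E) (b # c # cs)" using su s by auto
    then have "successively (\<lambda>u v. {u, v} \<in> E - {{l, a}}) (b # c # cs)"
      by (rule successively_mono) (use anin in \<open>auto simp: doubleton_eq_iff\<close>)
    then have "(b, l) \<in> (adj (E - {{l, a}}))\<^sup>*"
      using successively_reach[of "E - {{l, a}}" "b # c # cs"] by (simp add: l_def)
    moreover have "(a, b) \<in> adj (E - {{l, a}})"
      using d s l su by (auto simp: adj_def doubleton_eq_iff)
    ultimately have "(l, a) \<in> (adj (E - {{l, a}}))\<^sup>*"
      by (meson adj_sym converse_rtrancl_into_rtrancl)
    moreover have "l \<noteq> a" using anin l by auto
    ultimately show False using br e by blast
  qed
qed

lemma rtrancl_adj_insert:
  assumes "(p, q) \<in> (adj (insert {a, b} F))\<^sup>*"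
  shows "(p, q) \<in> (adj F)\<^sup>* \<or> ((p, a) \<in> (adj F)\<^sup>* \<and> (b, q) \<in> (adj F)\<^sup>*) \<or>
         ((p, b) \<in> (adj F)\<^sup>* \<and> (a, q) \<in> (adj F)\<^sup>*)"
  using assms
proof (induction rule: rtrancl_induct)
  case (step y z)
  from step(2) consider "(y, z) \<in> adj F" | "y = a" "z = b" | "y = b" "z = a"
    by (auto simp: adj_def doubleton_eq_iff)
  then show ?case
    by cases (use step(3) in \<open>auto intro: rtrancl_into_rtrancl\<close>)
qed auto

lemma card_2_obtain:
  assumes "E \<subseteq> complete_edges V" "e \<in> E"
  obtains u v where "e = {u, v}" "u \<noteq> v" "u \<in> V" "v \<in> V"
  using assms by (auto simp: complete_edges_def card_2_iff subset_iff)

lemma spanning_trees_exchange: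
  assumes E: "E \<subseteq> complete_edges V"
    and A: "A \<in> spanning_trees V E" and B: "B \<in> spanning_trees V E" and e: "e \<in> A - B"
  shows "\<exists>f \<in> B - A. insert f (A - {e}) \<in> spanning_trees V E"
proof -
  have AE: "A \<subseteq> E" and BE: "B \<subseteq> E" and Acon: "graph_connected V A"
    and Bcon: "graph_connected V B" and Aac: "graph_acyclic A"
    using A B by (auto simp: spanning_trees_def)
  obtain u v where uv: "e = {u, v}" "u \<noteq> v" "u \<in> V" "v \<in> V"
    using card_2_obtain[OF E] AE e by blast
  let ?R = "(adj (A - {e}))\<^sup>*"
  have nuv: "(u, v) \<notin> ?R"
    using Aac uv e by (auto simp: graph_acyclic_iff_bridges)
  have "\<exists>a b. (a, b) \<in> adj B \<and> (u, a) \<in> ?R \<and> (u, b) \<notin> ?R"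
  proof (rule ccontr)
    assume contr: "\<not> ?thesis"
    have "(u, v) \<in> (adj B)\<^sup>*" using Bcon uv by (auto simp: graph_connected_def)
    then have "(u, v) \<in> ?R"
      by (induction rule: rtrancl_induct) (use contr in auto)
    then show False using nuv by simp
  qed
  then obtain a b where ab: "{a, b} \<in> B" "(u, a) \<in> ?R" "(u, b) \<notin> ?R"
    by (auto simp: adj_def)
  have nab: "(a, b) \<notin> ?R" using ab by (meson rtrancl_trans)
  have "{a, b} \<notin> A - {e}" using nab by (auto simp: adj_def)
  moreover have "{a, b} \<noteq> e" using ab e by auto
  ultimately have f: "{a, b} \<in> B - A" using ab by auto
  let ?T = "insert {a, b} (A - {e})"
  have reach: "(u, x) \<in> ?R \<or> (v, x) \<in> ?R" if "x \<in> V" for x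
  proof -
    have "(u, x) \<in> (adj (insert {u, v} (A - {e})))\<^sup>*"
      using Acon that uv by (auto simp: graph_connected_def intro: adj_mono[rotated])
    from rtrancl_adj_insert[OF this] show ?thesis by blast
  qed
  have bV: "b \<in> V" using E BE ab(1) by (auto simp: complete_edges_def)
  have up: "(x, y) \<in> (adj ?T)\<^sup>*" if "(x, y) \<in> ?R" for x y
    using that by (rule adj_mono[rotated]) auto
  have "(a, b) \<in> adj ?T" by (auto simp: adj_def)
  moreover have "(v, b) \<in> ?R" using reach[OF bV] ab by auto
  ultimately have uvT: "(u, v) \<in> (adj ?T)\<^sup>*"
    by (meson ab(2) adj_sym rtrancl.rtrancl_into_rtrancl rtrancl_trans up)
  have "(u, x) \<in> (adj ?T)\<^sup>*" if "x \<in> V" for x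
    using reach[OF that] uvT up by (meson rtrancl_trans)
  then have "graph_connected V ?T"
    using Acon unfolding graph_connected_def by (meson adj_sym rtrancl_trans)
  moreover have "graph_acyclic ?T"
    unfolding graph_acyclic_iff_bridges
  proof (intro allI impI notI)
    fix p q assume pq: "p \<noteq> q" "{p, q} \<in> ?T" "(p, q) \<in> (adj (?T - {{p, q}}))\<^sup>*"
    show False
    proof (cases "{p, q} = {a, b}")
      case True
      have "?T - {{p, q}} = A - {e}" using True f by auto
      then have "(p, q) \<in> ?R" using pq by simp
      then show False using nab True by (auto simp: doubleton_eq_iff dest: adj_sym)
    next
      case False
      define F where "F = A - {e} - {{p, q}}"
      have "?T - {{p, q}} = insert {a, b} F" using False by (auto simp: F_def)
      then have cases: "(p, q) \<in> (adj F)\<^sup>* \<or> ((p, a) \<in> (adj F)\<^sup>* \<and> (b, q) \<in> (adj F)\<^sup>*) \<or>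
         ((p, b) \<in> (adj F)\<^sup>* \<and> (a, q) \<in> (adj F)\<^sup>*)"
        using rtrancl_adj_insert[of p q a b F] pq(3) by simp
      have pqA: "{p, q} \<in> A - {e}" using pq False by auto
      have "(p, q) \<in> adj (A - {e})" using pqA by (auto simp: adj_def)
      then have pqR: "(p, q) \<in> ?R" by auto
      have FR: "(x, y) \<in> ?R" if "(x, y) \<in> (adj F)\<^sup>*" for x y
        using that by (rule adj_mono[rotated]) (auto simp: F_def)
      have "(p, q) \<notin> (adj F)\<^sup>*"
        using Aac pqA pq(1) adj_mono[of F "A - {{p, q}}" p q]
        by (auto simp: graph_acyclic_iff_bridges F_def)
      then have "(a, b) \<in> ?R"
        using cases FR pqR by (meson adj_sym rtrancl_trans)
      then show False using nab by simp
    qed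
  qed
  ultimately have "?T \<in> spanning_trees V E"
    using AE BE ab by (auto simp: spanning_trees_def)
  then show ?thesis using f by blast
qed

lemma spanning_trees_nonempty:
  assumes "finite E" "graph_connected V E"
  shows "spanning_trees V E \<noteq> {}"
  using assms
proof (induction E rule: finite_psubset_induct)
  case (psubset E)
  show ?case
  proof (cases "graph_acyclic E")
    case True
    then show ?thesis using psubset by (auto simp: spanning_trees_def)
  next
    case False
    then obtain u v where uv: "{u, v} \<in> E" "(u, v) \<in> (adj (E - {{u, v}}))\<^sup>*"
      by (auto simp: graph_acyclic_iff_bridges)
    let ?F = "E - {{u, v}}"
    have "(x, y) \<in> (adj ?F)\<^sup>*" if "(x, y) \<in> (adj E)\<^sup>*" for x y
    proof -
      have "insert {u, v} ?F = E" using uv by auto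
      then show ?thesis
        using rtrancl_adj_insert[of x y u v ?F] that uv(2)
        by (metis adj_sym rtrancl_trans)
    qed
    then have "graph_connected V ?F" using psubset.prems by (auto simp: graph_connected_def)
    then have "spanning_trees V ?F \<noteq> {}" using psubset.IH[of ?F] uv by auto
    then show ?thesis by (auto simp: spanning_trees_def)
  qed
qed

theorem matroid_spanning_trees:
  assumes "finite V" "E \<subseteq> complete_edges V" "graph_connected V E"
  shows "matroid E (spanning_trees V E)"
proof
  show fin: "finite E"
    using assms by (auto simp: complete_edges_def intro: finite_subset[of _ "Pow V"])
  show "spanning_trees V E \<noteq> {}" using spanning_trees_nonempty fin assms by blast
  show "B \<subseteq> E" if "B \<in> spanning_trees V E" for B using that by (auto simp: spanning_trees_def)
qed (use spanning_trees_exchange assms in blast)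

corollary matroid_K:
  assumes "n > 0"
  shows "matroid (complete_edges {..<n}) (K_bases n)"
  unfolding K_bases_def
proof (rule matroid_spanning_trees)
  have "(u, v) \<in> (adj (complete_edges {..<n}))\<^sup>*" if "u < n" "v < n" for u v
    using that by (cases "u = v") (auto simp: adj_def complete_edges_def)
  then show "graph_connected {..<n} (complete_edges {..<n})"
    using assms by (auto simp: graph_connected_def)
qed auto

end

(*
  Deleting {0,5} or {2,3} from the hexagon 0-1-2-3-4-5-0 gives two adjacent spanning trees S and T.
  Kantorovich duality: a 1-Lipschitz function f with values 0, 1, 2 has mean 739/450 under P(S) and
  479/900 under P(T), so W(P(S), P(T)) >= 111/100.  The means are computed by cutting the
  Hamiltonian paths S and T at each edge: the trees containing the two pieces are exactly those
  obtained by joining them with an arbitrary edge.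
*)

theory Submission
  imports Defs
begin

section \<open>Spanning trees: antichain property and joining two trees by an edge\<close>

abbreviation trees :: "'v set \<Rightarrow> 'v set set set" where
  "trees V \<equiv> spanning_trees V (complete_edges V)"

lemma complete_edges_vertices: "E \<subseteq> complete_edges V \<Longrightarrow> {x, y} \<in> E \<Longrightarrow> x \<in> V \<and> y \<in> V"
  by (auto simp: complete_edges_def)

text \<open>An edge of \<open>B - A\<close> would have to be exchanged for an edge of
  \<open>A - B\<close>, which is empty. This stands in for counting edges.\<close>

lemma spanning_trees_antichain:
  assumes "E \<subseteq> complete_edges V" "A \<in> spanning_trees V E" "B \<in> spanning_trees V E" "A \<subseteq> B"
  shows "A = B"
  using spanning_trees_exchange[OF assms(1,3,2)] assms(4) by blast

text \<open>One step of the walk changes at most one edge. Exchanging \<open>e\<close> for an edge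
  of \<open>B\<close> yields a tree inside \<open>B\<close>, hence \<open>B\<close> itself by the
  antichain property.\<close>

lemma spanning_trees_eq_insertI:
  assumes "E \<subseteq> complete_edges V" "A \<in> spanning_trees V E" "B \<in> spanning_trees V E"
    and "A - {e} \<subseteq> B" "A \<noteq> B"
  shows "\<exists>f \<in> B - A. B = insert f (A - {e})"
proof -
  have "e \<in> A - B" using spanning_trees_antichain[OF assms(1-3)] assms(4,5) by blast
  then obtain f where f: "f \<in> B - A" "insert f (A - {e}) \<in> spanning_trees V E"
    using spanning_trees_exchange[OF assms(1-3)] by blast
  then have "insert f (A - {e}) = B"
    using spanning_trees_antichain[OF assms(1) f(2) assms(3)] assms(4) by blast
  then show ?thesis using f by blast
qed

text \<open>Every edge lies within \<open>C\<close> or within \<open>D\<close>, so a path that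
  starts in \<open>C\<close> never leaves \<open>C\<close> and uses edges of \<open>F\<close>
  only.\<close>

lemma rtrancl_adj_disjoint_Un:
  assumes "(p, q) \<in> (adj (F \<union> G))\<^sup>*" "p \<in> C"
    and "F \<subseteq> complete_edges C" "G \<subseteq> complete_edges D" "C \<inter> D = {}"
  shows "(p, q) \<in> (adj F)\<^sup>* \<and> q \<in> C"
  using assms(1,2)
proof (induction rule: rtrancl_induct)
  case (step y z)
  then have "(y, z) \<in> adj F \<and> z \<in> C"
    using assms(3-5) by (fastforce simp: adj_def complete_edges_def)
  with step show ?case by (auto intro: rtrancl_into_rtrancl)
qed auto

lemma trees_singleton: "{} \<in> trees {v}"
  by (auto simp: spanning_trees_def graph_connected_def graph_acyclic_iff_bridges)

text \<open>Acyclicity is checked through bridges. The new edge is a bridge since nothing else links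
  \<open>C\<close> to \<open>D\<close>; an old edge stays one since a detour crossing the new edge
  could not come back.\<close>

lemma trees_join:
  assumes F: "F \<in> trees C" and G: "G \<in> trees D" and CD: "C \<inter> D = {}"
    and x: "x \<in> C" and y: "y \<in> D"
  shows "insert {x, y} (F \<union> G) \<in> trees (C \<union> D)"
proof -
  let ?T = "insert {x, y} (F \<union> G)"
  have FC: "F \<subseteq> complete_edges C" and GD: "G \<subseteq> complete_edges D"
    and Fac: "graph_acyclic F" and Gac: "graph_acyclic G"
    and Fcon: "graph_connected C F" and Gcon: "graph_connected D G"
    using F G by (auto simp: spanning_trees_def)
  have xy: "x \<noteq> y" using x y CD by auto
  have nF: "{x, y} \<notin> F" and nG: "{x, y} \<notin> G"
    using complete_edges_vertices[OF FC] complete_edges_vertices[OF GD] x y CD by blast+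
  have DC: "D \<inter> C = {}" using CD by auto
  have "?T \<subseteq> complete_edges (C \<union> D)"
    using FC GD x y xy by (auto simp: complete_edges_def)
  moreover have "graph_connected (C \<union> D) ?T"
  proof -
    have xyT: "(x, y) \<in> (adj ?T)\<^sup>*" by (rule r_into_rtrancl) (simp add: adj_def)
    have "(x, z) \<in> (adj ?T)\<^sup>*" if "z \<in> C \<union> D" for z
    proof (cases "z \<in> C")
      case True
      then have "(x, z) \<in> (adj F)\<^sup>*" using Fcon x by (auto simp: graph_connected_def)
      then show ?thesis by (rule adj_mono[rotated]) auto
    next
      case False
      then have "(y, z) \<in> (adj G)\<^sup>*" using Gcon y that by (auto simp: graph_connected_def)
      then have "(y, z) \<in> (adj ?T)\<^sup>*" by (rule adj_mono[rotated]) auto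
      with xyT show ?thesis by (rule rtrancl_trans)
    qed
    then show ?thesis
      unfolding graph_connected_def using x by (metis Un_iff adj_sym empty_iff rtrancl_trans)
  qed
  moreover have "graph_acyclic ?T"
    unfolding graph_acyclic_iff_bridges
  proof (intro allI impI notI)
    fix p q assume pq: "p \<noteq> q" "{p, q} \<in> ?T" and r: "(p, q) \<in> (adj (?T - {{p, q}}))\<^sup>*"
    \<comment> \<open>\<open>H\<close> is the piece containing the edge, \<open>A\<close> its vertex
      set, and \<open>K\<close> the other piece on \<open>B\<close>; one argument then serves both
      \<open>F\<close> and \<open>G\<close>.\<close>
    have bridge: False
      if "H \<in> {F, G}" "{p, q} \<in> H" for H
    proof -
      have "\<exists>A B K. A \<inter> B = {} \<and> H \<subseteq> complete_edges A \<and> K \<subseteq> complete_edges B \<and>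
              F \<union> G = H \<union> K \<and> graph_acyclic H \<and> (x \<in> A \<longleftrightarrow> y \<notin> A)"
      proof (cases "H = F")
        case True
        then show ?thesis using FC GD CD Fac x y by (intro exI[of _ C] exI[of _ D] exI[of _ G]) auto
      next
        case False
        then show ?thesis using that FC GD DC Gac x y
          by (intro exI[of _ D] exI[of _ C] exI[of _ F]) auto
      qed
      then obtain A B K where AB: "A \<inter> B = {}" "H \<subseteq> complete_edges A" "K \<subseteq> complete_edges B"
        "F \<union> G = H \<union> K" "graph_acyclic H" "x \<in> A \<longleftrightarrow> y \<notin> A" by blast
      have pA: "p \<in> A" "q \<in> A" using that AB by (auto simp: complete_edges_def)
      have pK: "{p, q} \<notin> K" using pA AB by (auto simp: complete_edges_def)
      have "?T - {{p, q}} = insert {x, y} ((H - {{p, q}}) \<union> K)"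
        using AB pA pK by (auto simp: doubleton_eq_iff)
      \<comment> \<open>Either the detour stays inside \<open>H\<close>, contradicting acyclicity,
        or it uses the new edge, and then both \<open>x\<close> and \<open>y\<close> would lie in
        \<open>A\<close>.\<close>
      then consider "(p, q) \<in> (adj ((H - {{p, q}}) \<union> K))\<^sup>*"
        | "(p, x) \<in> (adj ((H - {{p, q}}) \<union> K))\<^sup>*" "(y, q) \<in> (adj ((H - {{p, q}}) \<union> K))\<^sup>*"
        | "(p, y) \<in> (adj ((H - {{p, q}}) \<union> K))\<^sup>*" "(x, q) \<in> (adj ((H - {{p, q}}) \<union> K))\<^sup>*"
        using rtrancl_adj_insert r by metis
      moreover have R: "(s, t) \<in> (adj (H - {{p, q}}))\<^sup>* \<and> t \<in> A"
        if "(s, t) \<in> (adj ((H - {{p, q}}) \<union> K))\<^sup>*" "s \<in> A" for s t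
        using rtrancl_adj_disjoint_Un[OF that _ AB(3,1)] AB(2) by blast
      ultimately show False
      proof cases
        case 1
        then show False using R[OF 1] pA AB(5) that pq(1) by (auto simp: graph_acyclic_iff_bridges)
      qed (use R pA AB(6) adj_sym in metis)+
    qed
    show False
    proof (cases "{p, q} = {x, y}")
      case True
      then have "(p, q) \<in> (adj (F \<union> G))\<^sup>*" using r nF nG by (simp add: insert_commute)
      then have "(x, y) \<in> (adj (F \<union> G))\<^sup>*" using True by (auto simp: doubleton_eq_iff intro: adj_sym)
      then show False using rtrancl_adj_disjoint_Un[OF _ x FC GD CD] y CD by auto
    next
      case False
      then show False using bridge pq by auto
    qed
  qed
  ultimately show ?thesis by (simp add: spanning_trees_def)
qed

text \<open>A connected \<open>T\<close> has an edge leaving \<open>C\<close>. Joining the pieces by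
  this edge gives a tree inside \<open>T\<close>, so the antichain property forces equality.\<close>

lemma trees_containing_two_trees:
  assumes F: "F \<in> trees C" and G: "G \<in> trees D" and CD: "C \<inter> D = {}"
  shows "{T \<in> trees (C \<union> D). F \<union> G \<subseteq> T} = (\<lambda>(x, y). insert {x, y} (F \<union> G)) ` (C \<times> D)"
proof (intro equalityI subsetI)
  fix T assume "T \<in> {T \<in> trees (C \<union> D). F \<union> G \<subseteq> T}"
  then have T: "T \<in> trees (C \<union> D)" "F \<union> G \<subseteq> T" by auto
  obtain c d where cd: "c \<in> C" "d \<in> D"
    using F G by (auto simp: spanning_trees_def graph_connected_def)
  have "(c, d) \<in> (adj T)\<^sup>*"
    using T cd by (auto simp: spanning_trees_def graph_connected_def)
  then have "\<exists>x y. x \<in> C \<and> y \<notin> C \<and> (x, y) \<in> adj T"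
  proof (rule contrapos_pp)
    assume contr: "\<nexists>x y. x \<in> C \<and> y \<notin> C \<and> (x, y) \<in> adj T"
    have "z \<in> C" if "(c, z) \<in> (adj T)\<^sup>*" for z
      using that by (induction rule: rtrancl_induct) (use cd contr in auto)
    then show "(c, d) \<notin> (adj T)\<^sup>*" using cd CD by auto
  qed
  then obtain x y where xy: "x \<in> C" "y \<notin> C" "{x, y} \<in> T" by (auto simp: adj_def)
  then have y: "y \<in> D" using T by (auto simp: spanning_trees_def complete_edges_def)
  have "insert {x, y} (F \<union> G) = T"
    using spanning_trees_antichain[OF order_refl trees_join[OF F G CD xy(1) y] T(1)] T(2) xy(3)
    by blast
  then show "T \<in> (\<lambda>(x, y). insert {x, y} (F \<union> G)) ` (C \<times> D)" using xy y by auto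
qed (use trees_join[OF F G CD] in auto)

section \<open>Paths, and the uniform tree containing two disjoint paths\<close>

fun path_edges :: "'v list \<Rightarrow> 'v set set" where
  "path_edges (x # y # zs) = insert {x, y} (path_edges (y # zs))"
| "path_edges _ = {}"

lemma path_edges_tree: "distinct vs \<Longrightarrow> vs \<noteq> [] \<Longrightarrow> path_edges vs \<in> trees (set vs)"
proof (induction vs rule: path_edges.induct)
  case (1 x y zs)
  then show ?case using trees_join[OF trees_singleton[of x], of "path_edges (y # zs)" "set (y # zs)" x y]
    by (auto simp: insert_commute)
qed (auto simp: trees_singleton)

lemma finite_trees: "finite V \<Longrightarrow> finite (trees V)"
  by (rule finite_subset[of _ "Pow (Pow V)"]) (auto simp: spanning_trees_def complete_edges_def)

text \<open>Distinct joining edges give distinct trees, so the uniform tree is the image of a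
  uniform pair of endpoints. Sums over lists let the simplifier evaluate the mean for concrete
  paths.\<close>

lemma nn_integral_trees_containing_two_paths:
  assumes "distinct (us @ ws)" "us \<noteq> []" "ws \<noteq> []"
  shows "(\<integral>\<^sup>+ X. of_nat (f X) \<partial>pmf_of_set {T \<in> trees (set (us @ ws)). path_edges us \<union> path_edges ws \<subseteq> T}) =
    ennreal (real (\<Sum>x\<leftarrow>us. \<Sum>y\<leftarrow>ws. f (insert {x, y} (path_edges us \<union> path_edges ws))) /
             real (length us * length ws))"
proof -
  let ?F = "path_edges us" and ?G = "path_edges ws"
  let ?g = "\<lambda>(x, y). insert {x, y} (?F \<union> ?G)"
  have d: "set us \<inter> set ws = {}" "distinct us" "distinct ws" using assms by auto
  have tr: "?F \<in> trees (set us)" "?G \<in> trees (set ws)" using assms by (auto intro: path_edges_tree)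
  then have sub: "?F \<subseteq> complete_edges (set us)" "?G \<subseteq> complete_edges (set ws)"
    by (auto simp: spanning_trees_def)
  have new: "{x, y} \<notin> ?F \<union> ?G" if "x \<in> set us" "y \<in> set ws" for x y
    using sub[THEN complete_edges_vertices] d(1) that by blast
  \<comment> \<open>The joining edge belongs to neither piece, so the tree determines it;
    disjointness tells its two ends apart.\<close>
  have eqD: "x = x' \<and> y = y'"
    if xy: "x \<in> set us" "y \<in> set ws" "x' \<in> set us" "y' \<in> set ws"
      and eq: "insert {x, y} (?F \<union> ?G) = insert {x', y'} (?F \<union> ?G)" for x y x' y'
  proof -
    have "{x, y} = {x', y'}" using new[OF xy(1,2)] eq by blast
    then show ?thesis using xy d(1) by (auto simp: doubleton_eq_iff)
  qed
  have inj: "inj_on ?g (set us \<times> set ws)"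
  proof (rule inj_onI)
    fix z z' assume z: "z \<in> set us \<times> set ws" "z' \<in> set us \<times> set ws" "?g z = ?g z'"
    obtain x y x' y' where xy: "z = (x, y)" "z' = (x', y')" by (cases z, cases z')
    show "z = z'" using eqD[of x y x' y'] z unfolding xy by simp
  qed
  have "pmf_of_set {T \<in> trees (set (us @ ws)). ?F \<union> ?G \<subseteq> T} = map_pmf ?g (pmf_of_set (set us \<times> set ws))"
    unfolding set_append trees_containing_two_trees[OF tr d(1)]
    by (rule map_pmf_of_set_inj[symmetric, OF inj]) (use assms in auto)
  then have "(\<integral>\<^sup>+ X. of_nat (f X) \<partial>pmf_of_set {T \<in> trees (set (us @ ws)). ?F \<union> ?G \<subseteq> T}) =
      (\<Sum>z\<in>set us \<times> set ws. of_nat (f (?g z))) / of_nat (card (set us \<times> set ws))"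
    using assms by (simp add: nn_integral_pmf_of_set)
  also have "\<dots> = of_nat (\<Sum>z\<in>set us \<times> set ws. f (?g z)) / of_nat (length us * length ws)"
    using d by (simp add: card_cartesian_product distinct_card)
  also have "(\<Sum>z\<in>set us \<times> set ws. f (?g z)) = (\<Sum>x\<leftarrow>us. \<Sum>y\<leftarrow>ws. f (insert {x, y} (?F \<union> ?G)))"
    using d by (simp add: sum.cartesian_product case_prod_unfold sum_list_distinct_conv_sum_set)
  finally show ?thesis
    using assms by (simp add: ennreal_of_nat_eq_real_of_nat divide_ennreal del: of_nat_mult of_nat_sum)
qed

section \<open>Lower bounds for transport cost and chain distance\<close>

text \<open>The easy half of Kantorovich duality: integrate \<open>f x\<close> \<le>
  \<open>d x y + f y\<close> over a coupling. Subtraction on \<open>nat\<close> truncates, so the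
  hypothesis constrains only pairs with \<open>f x > f y\<close>. The additive form avoids
  subtracting an infinite mean.\<close>

lemma wasserstein_lower_bound:
  fixes f :: "'s \<Rightarrow> nat"
  assumes "\<And>x y. x \<in> set_pmf \<mu> \<Longrightarrow> y \<in> set_pmf \<nu> \<Longrightarrow> enat (f x - f y) \<le> d x y"
  shows "(\<integral>\<^sup>+ x. of_nat (f x) \<partial>\<mu>) \<le> wasserstein d \<mu> \<nu> + (\<integral>\<^sup>+ y. of_nat (f y) \<partial>\<nu>)"
proof (cases "(\<integral>\<^sup>+ y. of_nat (f y) \<partial>\<nu>) = \<infinity>")
  case False
  have "(\<integral>\<^sup>+ x. of_nat (f x) \<partial>\<mu>) - (\<integral>\<^sup>+ y. of_nat (f y) \<partial>\<nu>) \<le> wasserstein d \<mu> \<nu>"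
    unfolding wasserstein_def
  proof (rule INF_greatest)
    fix \<xi> assume "\<xi> \<in> couplings \<mu> \<nu>"
    then have \<xi>: "map_pmf fst \<xi> = \<mu>" "map_pmf snd \<xi> = \<nu>" by (auto simp: couplings_def)
    have "(\<integral>\<^sup>+ x. of_nat (f x) \<partial>\<mu>) = (\<integral>\<^sup>+ z. of_nat (f (fst z)) \<partial>\<xi>)"
      by (simp flip: \<xi>(1))
    also have "\<dots> \<le> (\<integral>\<^sup>+ z. ennreal_of_enat (d (fst z) (snd z)) + of_nat (f (snd z)) \<partial>\<xi>)"
    proof (rule nn_integral_mono_AE, rule AE_pmfI)
      fix z assume z: "z \<in> set_pmf \<xi>"
      have "fst z \<in> set_pmf \<mu>" "snd z \<in> set_pmf \<nu>" using z \<xi> by auto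
      then have "ennreal_of_enat (enat (f (fst z) - f (snd z))) \<le> ennreal_of_enat (d (fst z) (snd z))"
        using assms by (simp only: ennreal_of_enat_le_iff)
      then have "of_nat (f (fst z) - f (snd z)) + of_nat (f (snd z)) \<le>
          ennreal_of_enat (d (fst z) (snd z)) + of_nat (f (snd z))"
        by (intro add_right_mono) simp
      \<comment> \<open>Truncation only increases the right-hand side.\<close>
      moreover have "(of_nat (f (fst z)) :: ennreal) \<le> of_nat (f (fst z) - f (snd z)) + of_nat (f (snd z))"
        unfolding of_nat_add[symmetric] by (rule of_nat_mono) simp
      ultimately show "of_nat (f (fst z)) \<le> ennreal_of_enat (d (fst z) (snd z)) + of_nat (f (snd z))"
        by (rule order_trans[rotated])
    qed
    also have "\<dots> = (\<integral>\<^sup>+ z. ennreal_of_enat (d (fst z) (snd z)) \<partial>\<xi>) + (\<integral>\<^sup>+ y. of_nat (f y) \<partial>\<nu>)"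
      by (subst nn_integral_add) (simp_all flip: \<xi>(2))
    finally show "(\<integral>\<^sup>+ x. of_nat (f x) \<partial>\<mu>) - (\<integral>\<^sup>+ y. of_nat (f y) \<partial>\<nu>) \<le>
        (\<integral>\<^sup>+ z. ennreal_of_enat (d (fst z) (snd z)) \<partial>\<xi>)"
      using False by (simp add: ennreal_minus_le_iff add.commute)
  qed
  then show ?thesis by (simp add: ennreal_minus_le_iff add.commute)
qed simp

lemma chain_dist_ge_1: "x \<noteq> y \<Longrightarrow> 1 \<le> chain_dist P x y"
  unfolding chain_dist_def
  by (rule INF_greatest) (auto simp: one_enat_def Suc_le_eq intro!: Nat.gr0I)

lemma chain_dist_ge_2:
  assumes "x \<noteq> y" "y \<notin> set_pmf (P x)"
  shows "2 \<le> chain_dist P x y"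
  unfolding chain_dist_def
proof (rule INF_greatest)
  fix t assume "t \<in> {t. 0 < pmf (kernel_power P t x) y}"
  then have "t \<noteq> 0" "t \<noteq> Suc 0"
    using assms by (auto simp: bind_return_pmf set_pmf_iff intro!: Nat.gr0I)
  then show "2 \<le> enat t" by (simp add: numeral_eq_enat)
qed

lemma chain_dist_eq_1:
  assumes "x \<noteq> y" "y \<in> set_pmf (P x)"
  shows "chain_dist P x y = 1"
proof (rule antisym)
  have "1 \<in> {t. 0 < pmf (kernel_power P t x) y}"
    using assms by (simp add: bind_return_pmf pmf_positive)
  then show "chain_dist P x y \<le> 1"
    unfolding chain_dist_def one_enat_def by (rule INF_lower)
qed (rule chain_dist_ge_1[OF assms(1)])

lemma set_basis_exchange_walk:
  assumes "finite \<B>" "S \<in> \<B>" "finite S" "S \<noteq> {}"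
  shows "set_pmf (basis_exchange_walk \<B> S) = {T \<in> \<B>. \<exists>u \<in> S. S - {u} \<subseteq> T}"
proof -
  \<comment> \<open>The set is finite and contains \<open>S\<close>, so \<open>pmf_of_set\<close> is
    a genuine uniform distribution.\<close>
  have "set_pmf (pmf_of_set {T \<in> \<B>. S - {u} \<subseteq> T}) = {T \<in> \<B>. S - {u} \<subseteq> T}" for u
    using assms by (intro set_pmf_of_set) auto
  then show ?thesis using assms by (auto simp: basis_exchange_walk_def)
qed

section \<open>The Lipschitz potential\<close>

text \<open>
  If \<open>potential X = 2\<close> and \<open>potential Y = 0\<close>, then \<open>X\<close> and \<open>Y\<close> differ in both \<open>{2, 3}\<close> and \<open>{0, 5}\<close>,
  so they are at distance 1 only if they have the same remaining edges \<open>Z\<close>; the predicate on \<open>Z\<close>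
  then lets only one of the two trees take its extreme value. It is chosen such that for the pairs
  near the two Hamiltonian paths the more likely tree of each pair wins.
\<close>

definition favours_23 :: "nat set set \<Rightarrow> bool" where
  "favours_23 Z \<longleftrightarrow>
     (if {1, 2} \<in> Z \<and> {3, 4} \<in> Z then {0, 5} \<subseteq> \<Union> Z else \<not> {2, 3} \<subseteq> \<Union> Z)"

definition potential :: "nat set set \<Rightarrow> nat" where
  "potential X =
     (if {2, 3} \<in> X \<and> {0, 5} \<notin> X \<and> favours_23 (X - {{2, 3}}) then 2
      else if {0, 5} \<in> X \<and> {2, 3} \<notin> X \<and> \<not> favours_23 (X - {{0, 5}}) then 0
      else 1)"

lemma potential_lipschitz:
  assumes X: "X \<in> K_bases 6" and Y: "Y \<in> K_bases 6"
  shows "enat (potential X - potential Y) \<le> chain_dist (basis_exchange_walk (K_bases 6)) X Y"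
proof -
  \<comment> \<open>As the values are 0, 1 and 2, only a drop from 2 to 0 needs more than
    \<open>chain_dist_ge_1\<close>.\<close>
  consider "potential X \<le> potential Y" | "X \<noteq> Y" "potential X - potential Y = 1"
    | "potential X = 2" "potential Y = 0"
  proof -
    have "potential Z \<in> {0, 1, 2}" for Z by (simp add: potential_def)
    from this[of X] this[of Y] show ?thesis using that by (cases "X = Y") fastforce+
  qed
  then show ?thesis
  proof cases
    case 1
    then show ?thesis by (simp add: zero_enat_def[symmetric])
  next
    case 2
    then show ?thesis using chain_dist_ge_1[OF 2(1)] by (simp add: one_enat_def)
  next
    case 3
    then have XY: "{2, 3} \<in> X" "{0, 5} \<notin> X" "favours_23 (X - {{2, 3}})"
      "{0, 5} \<in> Y" "{2, 3} \<notin> Y" "\<not> favours_23 (Y - {{0, 5}})"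
      by (auto simp: potential_def split: if_splits)
    have fin: "finite (K_bases 6)" "finite X"
      using X finite_trees by (auto simp: K_bases_def spanning_trees_def complete_edges_def
          intro!: finite_subset[of X "Pow {..<6}"])
    have "Y \<notin> set_pmf (basis_exchange_walk (K_bases 6) X)"
    proof
      assume "Y \<in> set_pmf (basis_exchange_walk (K_bases 6) X)"
      then obtain u where u: "X - {u} \<subseteq> Y"
        using set_basis_exchange_walk[OF fin(1) X fin(2)] XY(1) by auto
      have "X \<noteq> Y" using XY(1,5) by blast
      then obtain e where e: "Y = insert e (X - {u})"
        using spanning_trees_eq_insertI[OF order_refl _ _ u] X Y unfolding K_bases_def by blast
      \<comment> \<open>A single exchange from \<open>X\<close> to \<open>Y\<close> must trade {2,
        3} for {0, 5}. The remaining edges then coincide, and \<open>favours_23\<close> would be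
        both true and false of them.\<close>
      have "u = {2, 3}" using u XY(1,5) by blast
      moreover have "e = {0, 5}" using e XY(2,4) by blast
      ultimately have "Y = insert {0, 5} (X - {{2, 3}})" using e by simp
      then have "Y - {{0, 5}} = X - {{2, 3}}" using XY(2) by (metis Diff_iff Diff_insert_absorb)
      then show False using XY(3,6) by argo
    qed
    then have "2 \<le> chain_dist (basis_exchange_walk (K_bases 6)) X Y"
      using XY by (intro chain_dist_ge_2) auto
    then show ?thesis using 3 by (simp add: numeral_eq_enat)
  qed
qed

section \<open>One step of the walk from a Hamiltonian path\<close>

lemma path_edges_subset: "\<Union> (path_edges vs) \<subseteq> set vs"
  by (induction vs rule: path_edges.induct) auto

lemma finite_path_edges: "finite (path_edges vs)"
  by (induction vs rule: path_edges.induct) auto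

lemma path_edges_append:
  "us \<noteq> [] \<Longrightarrow> ws \<noteq> [] \<Longrightarrow>
    path_edges (us @ ws) = insert {last us, hd ws} (path_edges us \<union> path_edges ws)"
proof (induction us rule: path_edges.induct)
  case ("2_2" v)
  then show ?case by (cases ws) auto
qed auto

lemma path_edges_cut:
  assumes "distinct (us @ ws)" "us \<noteq> []" "ws \<noteq> []"
  shows "path_edges (us @ ws) - {{last us, hd ws}} = path_edges us \<union> path_edges ws"
proof -
  have "last us \<notin> set ws" "hd ws \<notin> set us"
    using assms(1) last_in_set[OF assms(2)] hd_in_set[OF assms(3)] unfolding distinct_append by blast+
  then have "{last us, hd ws} \<notin> path_edges us \<union> path_edges ws"
    using path_edges_subset[of us] path_edges_subset[of ws] by blast
  then show ?thesis unfolding path_edges_append[OF assms(2,3)] by blast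
qed

text \<open>Indexes the edges by position; distinctness ensures that none is counted twice. It gives
  both the number of edges and the average over the dropped edge.\<close>

lemma sum_path_edges:
  "distinct vs \<Longrightarrow> sum h (path_edges vs) = (\<Sum>k<length vs - 1. h {vs ! k, vs ! Suc k})"
proof (induction vs rule: path_edges.induct)
  case (1 x y zs)
  have "{x, y} \<notin> path_edges (y # zs)"
    using path_edges_subset[of "y # zs"] 1(2) by auto
  then have "sum h (path_edges (x # y # zs)) = h {x, y} + sum h (path_edges (y # zs))"
    by (simp add: finite_path_edges)
  then show ?case using 1 by (simp add: sum.lessThan_Suc_shift del: sum.lessThan_Suc)
qed auto

text \<open>Reduces the mean after one step to explicit arithmetic: average over the cut position,
  then over the edges that rejoin the two halves.\<close>

lemma nn_integral_walk_path:
  fixes f :: "'v set set \<Rightarrow> nat"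
  assumes "distinct vs" "2 \<le> length vs"
  shows "(\<integral>\<^sup>+ X. of_nat (f X) \<partial>basis_exchange_walk (trees (set vs)) (path_edges vs)) =
    ennreal ((\<Sum>k<length vs - 1. let us = take (Suc k) vs; ws = drop (Suc k) vs in
        real (\<Sum>x\<leftarrow>us. \<Sum>y\<leftarrow>ws. f (insert {x, y} (path_edges us \<union> path_edges ws))) /
        real (length us * length ws)) / real (length vs - 1))"
proof -
  define w where "w us ws = real (\<Sum>x\<leftarrow>us. \<Sum>y\<leftarrow>ws. f (insert {x, y} (path_edges us \<union> path_edges ws))) /
    real (length us * length ws)" for us ws
  have w: "0 \<le> w us ws" for us ws
    unfolding w_def by (intro divide_nonneg_nonneg of_nat_0_le_iff)
  let ?I = "\<lambda>u. \<integral>\<^sup>+ X. of_nat (f X) \<partial>pmf_of_set {T \<in> trees (set vs). path_edges vs - {u} \<subseteq> T}"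
  \<comment> \<open>Edge \<open>k\<close> joins positions \<open>k\<close> and \<open>Suc k\<close>,
    so dropping it leaves a prefix with \<open>Suc k\<close> vertices.\<close>
  have cut: "?I {vs ! k, vs ! Suc k} = ennreal (w (take (Suc k) vs) (drop (Suc k) vs))"
    if "k < length vs - 1" for k
  proof -
    define us ws where "us = take (Suc k) vs" and "ws = drop (Suc k) vs"
    have vs: "us @ ws = vs" by (simp add: us_def ws_def)
    have ne: "us \<noteq> []" "ws \<noteq> []" using that by (auto simp: us_def ws_def)
    have "vs ! k = last us" "vs ! Suc k = hd ws"
      using that by (simp_all add: us_def ws_def take_Suc_conv_app_nth hd_drop_conv_nth)
    moreover have d: "distinct (us @ ws)" using assms(1) vs by simp
    ultimately have "path_edges vs - {{vs ! k, vs ! Suc k}} = path_edges us \<union> path_edges ws"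
      using path_edges_cut[OF d ne] vs by simp
    then show ?thesis
      using nn_integral_trees_containing_two_paths[OF d ne, of f]
      unfolding vs us_def[symmetric] ws_def[symmetric] w_def by simp
  qed
  have card: "card (path_edges vs) = length vs - 1"
    unfolding card_eq_sum sum_path_edges[OF assms(1)] by simp
  then have "path_edges vs \<noteq> {}" using assms(2) by auto
  then have "(\<integral>\<^sup>+ X. of_nat (f X) \<partial>basis_exchange_walk (trees (set vs)) (path_edges vs)) =
      (\<Sum>u\<in>path_edges vs. ?I u) / of_nat (length vs - 1)"
    by (simp add: basis_exchange_walk_def nn_integral_pmf_of_set finite_path_edges card)
  also have "(\<Sum>u\<in>path_edges vs. ?I u) =
      (\<Sum>k<length vs - 1. ennreal (w (take (Suc k) vs) (drop (Suc k) vs)))"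
    unfolding sum_path_edges[OF assms(1)] using cut by (intro sum.cong) auto
  also have "\<dots> = ennreal (\<Sum>k<length vs - 1. w (take (Suc k) vs) (drop (Suc k) vs))"
    by (rule sum_ennreal) (rule w)
  also have "\<dots> / of_nat (length vs - 1) =
      ennreal ((\<Sum>k<length vs - 1. w (take (Suc k) vs) (drop (Suc k) vs)) / real (length vs - 1))"
    unfolding ennreal_of_nat_eq_real_of_nat
    by (rule divide_ennreal) (use assms(2) in \<open>auto intro: sum_nonneg w\<close>)
  finally show ?thesis unfolding w_def Let_def .
qed

section \<open>The two means and the curvature bound\<close>

lemma potential_means:
  "(\<integral>\<^sup>+ X. of_nat (potential X) \<partial>basis_exchange_walk (K_bases 6) (path_edges [0, 1, 2, 3, 4, 5])) =
    ennreal (739 / 450)" (is ?S)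
  "(\<integral>\<^sup>+ X. of_nat (potential X) \<partial>basis_exchange_walk (K_bases 6) (path_edges [3, 4, 5, 0, 1, 2])) =
    ennreal (479 / 900)" (is ?T)
proof -
  \<comment> \<open>The vertices are listed in the order of each path, to match
    \<open>set vs\<close> in \<open>nn_integral_walk_path\<close>.\<close>
  have set6: "{..<6} = set [0, 1, 2, 3, 4, 5 :: nat]" "{..<6} = set [3, 4, 5, 0, 1, 2 :: nat]"
    by auto
  show ?S
    unfolding K_bases_def set6(1)
    \<comment> \<open>The five cuts offer 5 + 8 + 9 + 8 + 5 = 35 rejoining edges, and the potential
      is evaluated at each resulting tree.\<close>
    by (subst nn_integral_walk_path)
      (simp_all add: potential_def favours_23_def doubleton_eq_iff insert_Diff_if)
  show ?T
    unfolding K_bases_def set6(2)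
    by (subst nn_integral_walk_path)
      (simp_all add: potential_def favours_23_def doubleton_eq_iff insert_Diff_if)
qed

theorem mainTheorem4:
  shows "ollivier_ricci (K_bases 6) (basis_exchange_walk (K_bases 6)) \<le> ereal (- 2 / 25) \<and>
         negatively_curved (K_bases 6) (basis_exchange_walk (K_bases 6))"
proof -
  let ?P = "basis_exchange_walk (K_bases 6)"
  define S where "S = path_edges [0, 1, 2, 3, 4, 5 :: nat]"
  define T where "T = path_edges [3, 4, 5, 0, 1, 2 :: nat]"
  let ?W = "wasserstein (chain_dist ?P) (?P S) (?P T)"
  have set6: "set [0, 1, 2, 3, 4, 5] = {..<6 :: nat}" "set [3, 4, 5, 0, 1, 2] = {..<6 :: nat}"
    by auto
  have S: "S \<in> K_bases 6" and T: "T \<in> K_bases 6"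
    using path_edges_tree[of "[0, 1, 2, 3, 4, 5 :: nat]"] path_edges_tree[of "[3, 4, 5, 0, 1, 2 :: nat]"]
    unfolding K_bases_def set6 S_def T_def by (simp_all del: path_edges.simps)
  have fin: "finite (K_bases 6)" by (simp add: K_bases_def finite_trees)
  have "finite S" "S \<noteq> {}" "finite T" "T \<noteq> {}" by (simp_all add: S_def T_def)
  then have supp: "set_pmf (?P S) = {X \<in> K_bases 6. \<exists>u \<in> S. S - {u} \<subseteq> X}"
    "set_pmf (?P T) = {X \<in> K_bases 6. \<exists>u \<in> T. T - {u} \<subseteq> X}"
    using set_basis_exchange_walk[OF fin S] set_basis_exchange_walk[OF fin T] by blast+
  have mem: "{2, 3} \<in> S" "{2, 3} \<notin> T" by (simp_all add: S_def T_def doubleton_eq_iff)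
  then have ne: "S \<noteq> T" by blast
  \<comment> \<open>Dropping {2, 3} from \<open>S\<close> leaves a subset of \<open>T\<close>, so
    the walk can reach \<open>T\<close> in one step.\<close>
  have "S \<subseteq> insert {2, 3} T" by (simp add: S_def T_def insert_commute)
  then have "T \<in> set_pmf (?P S)" unfolding supp using T mem by blast
  then have dist: "chain_dist ?P S T = 1" using ne by (rule chain_dist_eq_1[rotated])
  have "(\<integral>\<^sup>+ X. of_nat (potential X) \<partial>?P S) \<le> ?W + (\<integral>\<^sup>+ X. of_nat (potential X) \<partial>?P T)"
    by (rule wasserstein_lower_bound, rule potential_lipschitz) (use supp in blast)+
  then have "ennreal (739 / 450) \<le> ?W + ennreal (479 / 900)"
    unfolding S_def T_def potential_means .
  \<comment> \<open>739/450 - 479/900 = 999/900 = 111/100; an infinite \<open>?W\<close> satisfies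
    the bound trivially.\<close>
  then have W: "ereal (111 / 100) \<le> enn2ereal ?W"
    by (cases ?W) (auto simp flip: ennreal_plus)
  have "ollivier_ricci (K_bases 6) ?P \<le> 1 - enn2ereal ?W / ereal_of_enat (chain_dist ?P S T)"
    unfolding ollivier_ricci_def by (rule INF_lower2[of "(S, T)"]) (use S T ne in simp_all)
  also have "\<dots> = 1 - enn2ereal ?W"
    unfolding dist by (simp add: one_enat_def one_ereal_def[symmetric])
  \<comment> \<open>The pair actually yields 1 - 111/100 = -11/100, which is below -2/25.\<close>
  also have "\<dots> \<le> ereal (- 2 / 25)"
    using W by (cases "enn2ereal ?W") (auto simp: one_ereal_def)
  finally have le: "ollivier_ricci (K_bases 6) ?P \<le> ereal (- 2 / 25)" .
  then show ?thesis by (auto simp: negatively_curved_def intro: le_less_trans)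
qed

end
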